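(* Let $X$ be a $1$-skeletal simplicial set with finitely many non-degenerate simplices and let $p:X\to D_{\mathbb{B}}(\Delta_{\mathbb{Z}_2})$ be a simplicial distribution. Then $p$ is strongly contextual if and only if there exists $x\in X_0$ such that $\{A,D\}\subset\mathcal{C}(X,p)(x,x)$ or $\begin{pmatrix}0&1\\1&0\end{pmatrix}\in\mathcal{C}(X,p)(x,x)$, where $A=\begin{pmatrix}1&1\\1&0\end{pmatrix}$ and $D=\begin{pmatrix}0&1\\1&1\end{pmatrix}$.
   Context: $\mathbb{B}=\{0,1\}$ is the Boolean semiring ($1+1=1$). $D_{\mathbb{B}}(S)$ is the set of finitely supported functions $S\to\mathbb{B}$ that are not identically $0$ (i.e. sum to $1$), functorial by $D_{\mathbb{B}}(f)(p)(s')=\sum_{f(s)=s'}p(s)$, and $D_{\mathbb{B}}(Y)$ is obtained degreewise for a simplicial set $Y$. For a set $U$, $\Delta_U$ is the simplicial set with $(\Delta_U)_n=U^{n+1}$, $d_i$ deleting the $i$-th entry and $s_j$ repeating the $j$-th entry. A simplicial distribution is a simplicial set map $p:X\to D_{\mathbb{B}}(\Delta_{\mathbb{Z}_2})$; it is strongly contextual if there is no simplicial set map $\varphi:X\to\Delta_{\mathbb{Z}_2}$ with $p_n(x)(\varphi_n(x))\neq0$ for all $n$, $x\in X_n$. For a $1$-simplex $\sigma$, $p_\sigma\in D_{\mathbb{B}}(\mathbb{Z}_2\times\mathbb{Z}_2)$ is regarded as the $2\times2$ Boolean matrix with $(a,b)$-entry $p_\sigma(a,b)$, $a,b\in\{0,1\}$.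 The category $\mathcal{C}(X,p)$ has object set $X_0$. Each non-degenerate $1$-simplex $\sigma$ is regarded as an edge $d_1(\sigma)\to d_0(\sigma)$ labelled by the matrix $p_\sigma$ and also gives a reversed edge $\sigma^T:d_0(\sigma)\to d_1(\sigma)$ labelled by the transpose $p_\sigma^T$. The morphism set $\mathcal{C}(X,p)(x,y)$ is the set of all Boolean matrix products $M_1M_2\cdots M_k$ of labels along directed paths $x=x_0\to x_1\to\cdots\to x_k=y$ of such edges (the empty path at $x$ giving the identity matrix); composition is matrix multiplication in path order. *)

theory Defs
  imports "HOL-Analysis.Analysis"
begin

section \<open>The Boolean semiring\<close>

text \<open>The type \<^typ>\<open>bool\<close> is used as the semiring \<open>{0, 1}\<close> with \<open>1 + 1 = 1\<close>, so that
  library sums and matrix products apply to it.\<close>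

instantiation bool :: comm_semiring_1
begin

definition zero_bool_def: "(0::bool) = False"
definition one_bool_def: "(1::bool) = True"
definition plus_bool_def: "(a::bool) + b = (a \<or> b)"
definition times_bool_def: "(a::bool) * b = (a \<and> b)"

instance
  by standard (auto simp: zero_bool_def one_bool_def plus_bool_def times_bool_def)

end

section \<open>Simplicial sets\<close>

text \<open>For \<open>x\<close> in degree \<open>n\<close>, \<open>face X n i x\<close> is \<open>d\<^sub>i x\<close> (in degree \<open>n - 1\<close>, relevant for
  \<open>n \<ge> 1\<close>) and \<open>degen X n j x\<close> is \<open>s\<^sub>j x\<close> (in degree \<open>n + 1\<close>). The operators carry the degree
  of their argument because the sets of simplices of different degrees need not be disjoint.\<close>

record 'a sset =
  simplices :: "nat \<Rightarrow> 'a set"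
  face :: "nat \<Rightarrow> nat \<Rightarrow> 'a \<Rightarrow> 'a"
  degen :: "nat \<Rightarrow> nat \<Rightarrow> 'a \<Rightarrow> 'a"

locale simplicial_set =
  fixes X :: "'a sset"
  assumes face_closed:
      "\<lbrakk>x \<in> simplices X (Suc n); i \<le> Suc n\<rbrakk> \<Longrightarrow> face X (Suc n) i x \<in> simplices X n"
    and degen_closed:
      "\<lbrakk>x \<in> simplices X n; j \<le> n\<rbrakk> \<Longrightarrow> degen X n j x \<in> simplices X (Suc n)"
    and face_face:
      "\<lbrakk>x \<in> simplices X (Suc (Suc n)); i < j; j \<le> Suc (Suc n)\<rbrakk> \<Longrightarrow>
        face X (Suc n) i (face X (Suc (Suc n)) j x) =
        face X (Suc n) (j - 1) (face X (Suc (Suc n)) i x)"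
    and face_degen_less:
      "\<lbrakk>x \<in> simplices X (Suc n); i < j; j \<le> Suc n\<rbrakk> \<Longrightarrow>
        face X (Suc (Suc n)) i (degen X (Suc n) j x) = degen X n (j - 1) (face X (Suc n) i x)"
    and face_degen_same:
      "\<lbrakk>x \<in> simplices X n; j \<le> n\<rbrakk> \<Longrightarrow> face X (Suc n) j (degen X n j x) = x"
    and face_degen_Suc:
      "\<lbrakk>x \<in> simplices X n; j \<le> n\<rbrakk> \<Longrightarrow> face X (Suc n) (Suc j) (degen X n j x) = x"
    and face_degen_greater:
      "\<lbrakk>x \<in> simplices X (Suc n); Suc j < i; i \<le> Suc (Suc n)\<rbrakk> \<Longrightarrow>
        face X (Suc (Suc n)) i (degen X (Suc n) j x) = degen X n j (face X (Suc n) (i - 1) x)"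
    and degen_degen:
      "\<lbrakk>x \<in> simplices X n; i \<le> j; j \<le> n\<rbrakk> \<Longrightarrow>
        degen X (Suc n) i (degen X n j x) = degen X (Suc n) (Suc j) (degen X n i x)"

definition simplicial_map :: "'a sset \<Rightarrow> 'b sset \<Rightarrow> (nat \<Rightarrow> 'a \<Rightarrow> 'b) \<Rightarrow> bool" where
  "simplicial_map X Y f \<longleftrightarrow>
     (\<forall>n. \<forall>x\<in>simplices X n. f n x \<in> simplices Y n) \<and>
     (\<forall>n. \<forall>x\<in>simplices X (Suc n). \<forall>i\<le>Suc n.
        f n (face X (Suc n) i x) = face Y (Suc n) i (f (Suc n) x)) \<and>
     (\<forall>n. \<forall>x\<in>simplices X n. \<forall>j\<le>n.
        f (Suc n) (degen X n j x) = degen Y n j (f n x))"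

definition nondegenerate :: "'a sset \<Rightarrow> nat \<Rightarrow> 'a \<Rightarrow> bool" where
  "nondegenerate X n x \<longleftrightarrow>
     x \<in> simplices X n \<and>
     \<not> (\<exists>m j y. n = Suc m \<and> j \<le> m \<and> y \<in> simplices X m \<and> x = degen X m j y)"

definition skeletal :: "nat \<Rightarrow> 'a sset \<Rightarrow> bool" where
  "skeletal k X \<longleftrightarrow> (\<forall>n x. nondegenerate X n x \<longrightarrow> n \<le> k)"

text \<open>An \<open>n\<close>-simplex of \<open>\<Delta>\<^sub>U\<close>, i.e. an element of \<open>U\<^bsup>n+1\<^esup>\<close>, is a list of length \<open>n + 1\<close>.\<close>

definition Delta :: "'u set \<Rightarrow> 'u list sset" where
  "Delta U =
     \<lparr>simplices = (\<lambda>n. {xs. length xs = Suc n \<and> set xs \<subseteq> U}),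
      face = (\<lambda>n i xs. take i xs @ drop (Suc i) xs),
      degen = (\<lambda>n j xs. take (Suc j) xs @ drop j xs)\<rparr>"

section \<open>Boolean distributions\<close>

text \<open>Functions \<open>S \<rightarrow> {0, 1}\<close> are represented by their extension by \<open>0\<close> outside \<open>S\<close>.\<close>

definition distB :: "'s set \<Rightarrow> ('s \<Rightarrow> bool) set" where
  "distB S = {p. (\<forall>s. s \<notin> S \<longrightarrow> p s = 0) \<and> finite {s \<in> S. p s \<noteq> 0} \<and> (\<exists>s\<in>S. p s \<noteq> 0)}"

text \<open>The sum over the fibre is taken over the support only, which makes it a finite sum.\<close>

definition distB_map :: "('s \<Rightarrow> 't) \<Rightarrow> ('s \<Rightarrow> bool) \<Rightarrow> 't \<Rightarrow> bool" where
  "distB_map f p = (\<lambda>t. \<Sum>s | p s \<noteq> 0 \<and> f s = t. p s)"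

definition DB :: "'b sset \<Rightarrow> ('b \<Rightarrow> bool) sset" where
  "DB Y =
     \<lparr>simplices = (\<lambda>n. distB (simplices Y n)),
      face = (\<lambda>n i. distB_map (face Y n i)),
      degen = (\<lambda>n j. distB_map (degen Y n j))\<rparr>"

text \<open>The numeral type \<^typ>\<open>2\<close> is \<open>\<int>\<^sub>2\<close>, with elements \<open>0\<close> and \<open>1\<close>.\<close>

type_synonym Z2 = 2

definition simplicial_distribution :: "'a sset \<Rightarrow> (nat \<Rightarrow> 'a \<Rightarrow> Z2 list \<Rightarrow> bool) \<Rightarrow> bool" where
  "simplicial_distribution X p \<longleftrightarrow> simplicial_map X (DB (Delta (UNIV :: Z2 set))) p"

definition strongly_contextual :: "'a sset \<Rightarrow> (nat \<Rightarrow> 'a \<Rightarrow> Z2 list \<Rightarrow> bool) \<Rightarrow> bool" where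
  "strongly_contextual X p \<longleftrightarrow>
     \<not> (\<exists>\<phi>. simplicial_map X (Delta (UNIV :: Z2 set)) \<phi> \<and>
            (\<forall>n. \<forall>x\<in>simplices X n. p n x (\<phi> n x) \<noteq> 0))"

section \<open>The category of a simplicial distribution\<close>

text \<open>Rows and columns are indexed by \<open>\<int>\<^sub>2 = {0, 1}\<close>, in this order. (The library function
  \<^const>\<open>vector\<close> instead starts at index \<open>1\<close> and would put index \<open>0 = 2\<close> last.)\<close>

type_synonym bmat = "bool ^ Z2 ^ Z2"

definition mat2 :: "bool \<Rightarrow> bool \<Rightarrow> bool \<Rightarrow> bool \<Rightarrow> bmat" where
  "mat2 m00 m01 m10 m11 =
     (\<chi> a b. if a = 0 then (if b = 0 then m00 else m01) else (if b = 0 then m10 else m11))"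

definition edge_matrix :: "(nat \<Rightarrow> 'a \<Rightarrow> Z2 list \<Rightarrow> bool) \<Rightarrow> 'a \<Rightarrow> bmat" where
  "edge_matrix p \<sigma> = (\<chi> a b. p 1 \<sigma> [a, b])"

text \<open>Labelled edges are triples (source, label, target).\<close>

definition edges ::
    "'a sset \<Rightarrow> (nat \<Rightarrow> 'a \<Rightarrow> Z2 list \<Rightarrow> bool) \<Rightarrow> ('a \<times> bmat \<times> 'a) set" where
  "edges X p =
     {(face X 1 1 \<sigma>, edge_matrix p \<sigma>, face X 1 0 \<sigma>) | \<sigma>. nondegenerate X 1 \<sigma>} \<union>
     {(face X 1 0 \<sigma>, transpose (edge_matrix p \<sigma>), face X 1 1 \<sigma>) | \<sigma>. nondegenerate X 1 \<sigma>}"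

fun is_path :: "('a \<times> bmat \<times> 'a) set \<Rightarrow> 'a \<Rightarrow> ('a \<times> bmat \<times> 'a) list \<Rightarrow> 'a \<Rightarrow> bool" where
  "is_path E x [] y \<longleftrightarrow> x = y"
| "is_path E x ((u, M, v) # es) y \<longleftrightarrow> (u, M, v) \<in> E \<and> u = x \<and> is_path E v es y"

fun path_product :: "('a \<times> bmat \<times> 'a) list \<Rightarrow> bmat" where
  "path_product [] = mat 1"
| "path_product ((u, M, v) # es) = M ** path_product es"

definition Hom_cat ::
    "'a sset \<Rightarrow> (nat \<Rightarrow> 'a \<Rightarrow> Z2 list \<Rightarrow> bool) \<Rightarrow> 'a \<Rightarrow> 'a \<Rightarrow> bmat set" where
  "Hom_cat X p x y =
     {path_product es | es. x \<in> simplices X 0 \<and> y \<in> simplices X 0 \<and> is_path (edges X p) x es y}"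

text \<open>Consistency checks: the constructions above yield simplicial sets, and the morphism sets
  contain identities and are closed under composition.\<close>

lemma face_Delta:
  assumes "x \<in> simplices (Delta U) (Suc n)" "i \<le> Suc n"
  shows "face (Delta U) (Suc n) i x = map (\<lambda>k. x ! (if k < i then k else Suc k)) [0..<Suc n]"
  using assms by (intro nth_equalityI) (auto simp: Delta_def nth_append min_def simp del: upt_Suc)

lemma degen_Delta:
  assumes "x \<in> simplices (Delta U) n" "j \<le> n"
  shows "degen (Delta U) n j x = map (\<lambda>k. x ! (if k \<le> j then k else k - 1)) [0..<Suc (Suc n)]"
proof (rule nth_equalityI)
  fix k assume "k < length (degen (Delta U) n j x)"
  then show "degen (Delta U) n j x ! k =
      map (\<lambda>k. x ! (if k \<le> j then k else k - 1)) [0..<Suc (Suc n)] ! k"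
    using assms by (cases "k \<le> j") (auto simp: Delta_def nth_append min_def simp del: upt_Suc)
qed (use assms in \<open>auto simp: Delta_def\<close>)

lemma length_Delta: "x \<in> simplices (Delta U) n \<Longrightarrow> length x = Suc n"
  by (simp add: Delta_def)

lemma simplicial_set_Delta: "simplicial_set (Delta U)"
proof -
  have fc: "face (Delta U) (Suc n) i x \<in> simplices (Delta U) n"
    if "x \<in> simplices (Delta U) (Suc n)" "i \<le> Suc n" for x n i
    using that by (auto simp: Delta_def dest: in_set_takeD in_set_dropD)
  have dc: "degen (Delta U) n j x \<in> simplices (Delta U) (Suc n)"
    if "x \<in> simplices (Delta U) n" "j \<le> n" for x n j
    using that by (auto simp: Delta_def dest: in_set_takeD in_set_dropD)
  note [simp del] = upt_Suc
  show ?thesis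
  proof (standard, goal_cases)
    case (1 x n i)
    then show ?case by (rule fc)
  next
    case (2 x n j)
    then show ?case by (rule dc)
  next
    case (3 x n i j)
    have "face (Delta U) (Suc n) i (face (Delta U) (Suc (Suc n)) j x) =
        map (\<lambda>k. face (Delta U) (Suc (Suc n)) j x ! (if k < i then k else Suc k)) [0..<Suc n]"
      using 3 by (intro face_Delta fc) auto
    moreover have "face (Delta U) (Suc n) (j - 1) (face (Delta U) (Suc (Suc n)) i x) =
        map (\<lambda>k. face (Delta U) (Suc (Suc n)) i x ! (if k < j - 1 then k else Suc k)) [0..<Suc n]"
      using 3 by (intro face_Delta fc) auto
    ultimately show ?case using 3 by (auto simp: face_Delta[OF 3(1)])
  next
    case (4 x n i j)
    have "face (Delta U) (Suc (Suc n)) i (degen (Delta U) (Suc n) j x) =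
        map (\<lambda>k. degen (Delta U) (Suc n) j x ! (if k < i then k else Suc k)) [0..<Suc (Suc n)]"
      using 4 by (intro face_Delta dc) auto
    moreover have "degen (Delta U) n (j - 1) (face (Delta U) (Suc n) i x) =
        map (\<lambda>k. face (Delta U) (Suc n) i x ! (if k \<le> j - 1 then k else k - 1)) [0..<Suc (Suc n)]"
      using 4 by (intro degen_Delta fc) auto
    ultimately show ?case using 4 by (auto simp: face_Delta[OF 4(1)] degen_Delta[OF 4(1)])
  next
    case (5 x n j)
    have "face (Delta U) (Suc n) j (degen (Delta U) n j x) =
        map (\<lambda>k. degen (Delta U) n j x ! (if k < j then k else Suc k)) [0..<Suc n]"
      using 5 by (intro face_Delta dc) auto
    then show ?case using 5 length_Delta[OF 5(1)]
      by (auto simp: degen_Delta[OF 5(1)] intro!: nth_equalityI)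
  next
    case (6 x n j)
    have "face (Delta U) (Suc n) (Suc j) (degen (Delta U) n j x) =
        map (\<lambda>k. degen (Delta U) n j x ! (if k < Suc j then k else Suc k)) [0..<Suc n]"
      using 6 by (intro face_Delta dc) auto
    then show ?case using 6 length_Delta[OF 6(1)]
      by (auto simp: degen_Delta[OF 6(1)] intro!: nth_equalityI)
  next
    case (7 x n j i)
    have "face (Delta U) (Suc (Suc n)) i (degen (Delta U) (Suc n) j x) =
        map (\<lambda>k. degen (Delta U) (Suc n) j x ! (if k < i then k else Suc k)) [0..<Suc (Suc n)]"
      using 7 by (intro face_Delta dc) auto
    moreover have "degen (Delta U) n j (face (Delta U) (Suc n) (i - 1) x) =
        map (\<lambda>k. face (Delta U) (Suc n) (i - 1) x ! (if k \<le> j then k else k - 1)) [0..<Suc (Suc n)]"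
      using 7 by (intro degen_Delta fc) auto
    ultimately show ?case using 7 by (auto simp: face_Delta[OF 7(1)] degen_Delta[OF 7(1)])
  next
    case (8 x n i j)
    have "degen (Delta U) (Suc n) i (degen (Delta U) n j x) =
        map (\<lambda>k. degen (Delta U) n j x ! (if k \<le> i then k else k - 1)) [0..<Suc (Suc (Suc n))]"
      using 8 by (intro degen_Delta dc) auto
    moreover have "degen (Delta U) (Suc n) (Suc j) (degen (Delta U) n i x) =
        map (\<lambda>k. degen (Delta U) n i x ! (if k \<le> Suc j then k else k - 1)) [0..<Suc (Suc (Suc n))]"
      using 8 by (intro degen_Delta dc) auto
    ultimately show ?case using 8 by (auto simp: degen_Delta[OF 8(1)])
  qed
qed

lemma distB_map_iff: "finite {s. p s \<noteq> 0} \<Longrightarrow> distB_map f p t \<longleftrightarrow> (\<exists>s. p s \<and> f s = t)"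
proof -
  assume fin: "finite {s. p s \<noteq> 0}"
  have *: "sum p A \<longleftrightarrow> (\<exists>s\<in>A. p s)" if "finite A" for A
    using that by (induction A) (auto simp: zero_bool_def plus_bool_def)
  show ?thesis
    unfolding distB_map_def
    by (subst *) (auto intro: finite_subset[OF _ fin] simp: zero_bool_def)
qed

lemma distB_iff: "p \<in> distB S \<longleftrightarrow> (\<forall>s. p s \<longrightarrow> s \<in> S) \<and> finite {s. p s} \<and> (\<exists>s. p s)"
proof (cases "\<forall>s. p s \<longrightarrow> s \<in> S")
  case True
  then have "{s \<in> S. p s} = {s. p s}" "(\<exists>s\<in>S. p s) \<longleftrightarrow> (\<exists>s. p s)" by auto
  then show ?thesis using True unfolding distB_def zero_bool_def by auto
next
  case False
  then show ?thesis unfolding distB_def zero_bool_def by auto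
qed

lemma distB_map_distB:
  assumes "p \<in> distB S" "\<And>s. s \<in> S \<Longrightarrow> f s \<in> T"
  shows "distB_map f p \<in> distB T"
proof -
  have fin: "finite {s. p s}" using assms by (auto simp: distB_iff)
  have "distB_map f p t \<longleftrightarrow> (\<exists>s. p s \<and> f s = t)" for t
    using distB_map_iff[of p f t] fin by (simp add: zero_bool_def)
  then have eq: "distB_map f p = (\<lambda>t. \<exists>s. p s \<and> f s = t)" by (rule ext)
  have "{t. \<exists>s. p s \<and> f s = t} = f ` {s. p s}" by auto
  then have "finite {t. \<exists>s. p s \<and> f s = t}" using fin by simp
  then show ?thesis using assms unfolding eq distB_iff by blast
qed

lemma distB_map_comp:
  assumes "p \<in> distB S"
  shows "distB_map g (distB_map f p) = distB_map (g \<circ> f) p"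
proof
  fix t
  have fin: "finite {s. p s \<noteq> 0}" using assms by (simp add: distB_iff zero_bool_def)
  have "distB_map f p \<in> distB UNIV" by (rule distB_map_distB[OF assms]) simp
  then have "finite {s. distB_map f p s \<noteq> 0}" by (simp add: distB_iff zero_bool_def)
  then have "distB_map g (distB_map f p) t \<longleftrightarrow> (\<exists>s. distB_map f p s \<and> g s = t)"
    by (rule distB_map_iff)
  also have "\<dots> \<longleftrightarrow> (\<exists>s. p s \<and> (g \<circ> f) s = t)"
    unfolding distB_map_iff[OF fin] by auto
  also have "\<dots> \<longleftrightarrow> distB_map (g \<circ> f) p t"
    by (rule distB_map_iff[OF fin, symmetric])
  finally show "distB_map g (distB_map f p) t = distB_map (g \<circ> f) p t" .
qed

lemma distB_map_cong:
  assumes "p \<in> distB S" "\<And>s. s \<in> S \<Longrightarrow> f s = g s"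
  shows "distB_map f p = distB_map g p"
proof -
  have "{s. p s \<noteq> 0 \<and> f s = t} = {s. p s \<noteq> 0 \<and> g s = t}" for t
  proof (rule Collect_cong)
    fix s
    show "p s \<noteq> 0 \<and> f s = t \<longleftrightarrow> p s \<noteq> 0 \<and> g s = t"
    proof (cases "s \<in> S")
      case True
      then show ?thesis by (simp add: assms(2))
    next
      case False
      then show ?thesis using assms(1) by (simp add: distB_def)
    qed
  qed
  then show ?thesis unfolding distB_map_def by simp
qed

lemma distB_map_id:
  assumes "p \<in> distB S" "\<And>s. s \<in> S \<Longrightarrow> f s = s"
  shows "distB_map f p = p"
proof -
  have "finite {s. p s \<noteq> 0}" using assms(1) by (simp add: distB_iff zero_bool_def)
  then have "distB_map (\<lambda>s. s) p = p" by (simp add: distB_map_iff fun_eq_iff)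
  moreover have "distB_map f p = distB_map (\<lambda>s. s) p"
    by (rule distB_map_cong[OF assms(1)]) (rule assms(2))
  ultimately show ?thesis by simp
qed

lemma simplicial_set_DB:
  assumes "simplicial_set Y"
  shows "simplicial_set (DB Y)"
proof -
  interpret Y: simplicial_set Y by fact
  show ?thesis
    by standard
      (auto simp: DB_def Y.face_closed Y.degen_closed distB_map_comp Y.face_face Y.face_degen_less
        Y.face_degen_same Y.face_degen_Suc Y.face_degen_greater Y.degen_degen
        intro!: distB_map_distB distB_map_cong distB_map_id)
qed

lemma Hom_cat_id: "x \<in> simplices X 0 \<Longrightarrow> mat 1 \<in> Hom_cat X p x x"
  unfolding Hom_cat_def by (auto intro!: exI[of _ "[]"])

lemma Hom_cat_comp:
  assumes "M \<in> Hom_cat X p x y" "N \<in> Hom_cat X p y z"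
  shows "M ** N \<in> Hom_cat X p x z"
proof -
  have path: "is_path E x es y \<Longrightarrow> is_path E y fs z \<Longrightarrow> is_path E x (es @ fs) z"
    for E :: "('a \<times> bmat \<times> 'a) set" and x y z es fs
    by (induction E x es y rule: is_path.induct) auto
  have prod: "path_product (es @ fs) = path_product es ** path_product fs"
    for es fs :: "('a \<times> bmat \<times> 'a) list"
    by (induction es rule: path_product.induct) (auto simp: matrix_mul_assoc)
  show ?thesis using assms unfolding Hom_cat_def by (force simp: prod[symmetric] dest: path)
qed

end

theory Submission
  imports Defs
begin

text \<open>A simplicial map into \<open>\<Delta>\<close> is a labelling of the vertices, and on a \<open>1\<close>-skeletal \<open>X\<close> the
  support of \<open>p\<close> only constrains it on vertices and non-degenerate edges: non-contextuality is the
  satisfiability of a system of binary Boolean constraints. Compatibility of \<open>p\<close> with faces makes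
  the system arc consistent, so a failed entry of a morphism forces the opposite value, as in the
  implication graph of 2-SAT. If some value at \<open>x\<close> is not refuted by a loop at \<open>x\<close>, everything it
  forces is a consistent partial labelling that can be adjoined to any partial labelling closed
  under forcing and not defined at \<open>x\<close>; adjoining such pieces vertex by vertex gives a solution.
  So an unsatisfiable system has a vertex both of whose values are refuted by loops. Such loops have
  no zero row or column, and the only \<open>2 \<times> 2\<close> matrices of this kind with a zero on the diagonal
  are \<open>A\<close>, \<open>D\<close> and the swap.\<close>

section \<open>Arc consistent systems of Boolean constraints\<close>

lemma Z2_cases: "(a::Z2) = 0 \<or> a = 1"
  using exhaust_2[of a] by (auto simp: num1_eq1)

lemma Z2_neq_trans: "(a::Z2) \<noteq> b \<Longrightarrow> c \<noteq> b \<Longrightarrow> a = c"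
  using Z2_cases[of a] Z2_cases[of b] Z2_cases[of c] by auto

lemma bool_matrix_mult_iff:
  fixes M N :: bmat
  shows "(M ** N) $ a $ b \<longleftrightarrow> (\<exists>c. M $ a $ c \<and> N $ c $ b)"
proof -
  have *: "sum f A \<longleftrightarrow> (\<exists>c\<in>A. f c)" if "finite A" for f :: "Z2 \<Rightarrow> bool" and A
    using that by (induction A) (auto simp: zero_bool_def plus_bool_def)
  show ?thesis
    by (simp add: matrix_matrix_mult_def * times_bool_def)
qed

lemma bool_mat_1_iff: "(mat 1 :: bmat) $ a $ b \<longleftrightarrow> a = b"
  by (simp add: mat_def one_bool_def zero_bool_def)

lemma mat2_eqI:
  assumes "M $ 0 $ 0 = a" "M $ 0 $ 1 = b" "M $ 1 $ 0 = c" "M $ 1 $ 1 = d"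
  shows "M = mat2 a b c d"
proof -
  have "M $ i $ j = mat2 a b c d $ i $ j" for i j
    using Z2_cases[of i] Z2_cases[of j] assms by (auto simp: mat2_def)
  then show ?thesis by (simp add: vec_eq_iff)
qed

text \<open>Variables \<open>V\<close> with possible values \<open>D x\<close>; \<open>total\<close>
  is arc consistency. \<open>H x y\<close> holds all composite constraints, not only generators, so
  that a chain of implications is witnessed by a single matrix.\<close>

locale boolean_constraints =
  fixes V :: "'v set" and H :: "'v \<Rightarrow> 'v \<Rightarrow> bmat set" and D :: "'v \<Rightarrow> Z2 set"
  assumes finite_V: "finite V"
    and dom_nonempty: "x \<in> V \<Longrightarrow> D x \<noteq> {}"
    and hom_V: "M \<in> H x y \<Longrightarrow> x \<in> V \<and> y \<in> V"
    and hom_id: "x \<in> V \<Longrightarrow> mat 1 \<in> H x x"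
    and hom_comp: "M \<in> H x y \<Longrightarrow> N \<in> H y z \<Longrightarrow> M ** N \<in> H x z"
    and hom_transpose: "M \<in> H x y \<Longrightarrow> transpose M \<in> H y x"
    and total: "M \<in> H x y \<Longrightarrow> a \<in> D x \<Longrightarrow> \<exists>b\<in>D y. M $ a $ b"
begin

text \<open>Row \<open>snd s\<close> of some morphism is a unit vector: an edge of the implication
  graph, already transitively closed because \<open>H\<close> is closed under products.\<close>

definition forces :: "'v \<times> Z2 \<Rightarrow> 'v \<times> Z2 \<Rightarrow> bool" where
  "forces s t \<longleftrightarrow> (\<exists>M\<in>H (fst s) (fst t). \<forall>c. M $ snd s $ c \<longleftrightarrow> c = snd t)"

text \<open>Encoded as a single-valued relation, so that adjoining a piece is a union. Closure under
  forcing is what keeps later pieces from clashing with it.\<close>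

definition partial_solution :: "('v \<times> Z2) set \<Rightarrow> bool" where
  "partial_solution S \<longleftrightarrow>
     (\<forall>(x, a)\<in>S. x \<in> V \<and> a \<in> D x) \<and>
     (\<forall>x a b. (x, a) \<in> S \<longrightarrow> (x, b) \<in> S \<longrightarrow> a = b) \<and>
     (\<forall>s\<in>S. \<forall>t. forces s t \<longrightarrow> t \<in> S)"

text \<open>For \<open>a\<close> in \<open>D x\<close>, a loop with a zero at \<open>(a, a)\<close>
  would force the opposite value at \<open>x\<close> itself.\<close>

definition unrefuted :: "'v \<Rightarrow> Z2 \<Rightarrow> bool" where
  "unrefuted x a \<longleftrightarrow> (\<forall>M\<in>H x x. M $ a $ a)"

section \<open>Rules for forcing\<close>

lemma forces_refl: "x \<in> V \<Longrightarrow> forces (x, a) (x, a)"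
  unfolding forces_def by (auto intro!: bexI[of _ "mat 1"] simp: bool_mat_1_iff hom_id)

lemma forces_trans:
  assumes "forces s t" "forces t u"
  shows "forces s u"
proof -
  obtain M N where M: "M \<in> H (fst s) (fst t)" "\<And>c. M $ snd s $ c \<longleftrightarrow> c = snd t"
    and N: "N \<in> H (fst t) (fst u)" "\<And>c. N $ snd t $ c \<longleftrightarrow> c = snd u"
    using assms unfolding forces_def by metis
  have "(M ** N) $ snd s $ c \<longleftrightarrow> c = snd u" for c
    by (simp add: bool_matrix_mult_iff M(2) N(2))
  then show ?thesis unfolding forces_def using hom_comp[OF M(1) N(1)] by blast
qed

lemma forces_dom: "forces (x, a) (y, b) \<Longrightarrow> a \<in> D x \<Longrightarrow> y \<in> V \<and> b \<in> D y"
  unfolding forces_def using total hom_V by fastforce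

text \<open>Row \<open>a\<close> is nonzero by \<open>total\<close>, and only one other column is
  left for its nonzero entry.\<close>

lemma failure_forces:
  assumes "M \<in> H x y" "a \<in> D x" "\<not> M $ a $ b" "c \<noteq> b"
  shows "forces (x, a) (y, c)"
proof -
  obtain d where d: "M $ a $ d" using total[OF assms(1,2)] by blast
  with assms have "d = c" using Z2_neq_trans[of d b c] by auto
  then have "M $ a $ e \<longleftrightarrow> e = c" for e
    using d assms Z2_neq_trans[of e b c] by auto
  then show ?thesis unfolding forces_def using assms(1) by auto
qed

text \<open>The forcing row is zero at \<open>b'\<close>, so the transpose has a failed entry at
  \<open>(b', a)\<close>, and \<open>failure_forces\<close> applies to it.\<close>

lemma forces_contrapositive:
  assumes "forces (x, a) (y, b)" "b' \<in> D y" "b' \<noteq> b" "a' \<noteq> a"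
  shows "forces (y, b') (x, a')"
proof -
  obtain M where "M \<in> H x y" "\<And>c. M $ a $ c \<longleftrightarrow> c = b"
    using assms(1) unfolding forces_def by auto
  then show ?thesis
    using failure_forces[OF hom_transpose[of M x y] assms(2) _ assms(4)] assms(3)
    by (auto simp: transpose_def)
qed

text \<open>Go out along one witness and return along the transpose of the other: this loop is
  nonzero at \<open>(a, a)\<close> only if the two unit rows coincide.\<close>

lemma unrefuted_forces_consistent:
  assumes "unrefuted x a" "forces (x, a) (y, b)" "forces (x, a) (y, c)"
  shows "b = c"
proof -
  obtain M N where M: "M \<in> H x y" "\<And>d. M $ a $ d \<longleftrightarrow> d = b"
    and N: "N \<in> H x y" "\<And>d. N $ a $ d \<longleftrightarrow> d = c"
    using assms(2,3) unfolding forces_def by auto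
  have "(M ** transpose N) $ a $ a"
    using assms(1) hom_comp[OF M(1) hom_transpose[OF N(1)]] unfolding unrefuted_def by blast
  then show ?thesis by (simp add: bool_matrix_mult_iff transpose_def M(2) N(2))
qed

section \<open>Assembling a global solution\<close>

lemma extend_partial_solution:
  assumes S: "partial_solution S" and x: "x \<in> V" "a \<in> D x" "unrefuted x a"
    and new: "x \<notin> fst ` S"
  shows "partial_solution (S \<union> {t. forces (x, a) t})"
proof -
  have dom: "y \<in> V \<and> b \<in> D y" if "(y, b) \<in> S" for y b
    using S that unfolding partial_solution_def by blast
  have closed: "t \<in> S" if "s \<in> S" "forces s t" for s t
    using S that unfolding partial_solution_def by blast
  have uniq: "b = c" if "(y, b) \<in> S" "(y, c) \<in> S" for y b c
    using S that unfolding partial_solution_def by blast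
  \<comment> \<open>By contraposition, a disagreement at \<open>y\<close> would make the old value
    force a value at \<open>x\<close>; closure would then put \<open>x\<close> into the domain of
    \<open>S\<close>.\<close>
  have clash: "b = c" if "(y, b) \<in> S" "forces (x, a) (y, c)" for y b c
  proof (rule ccontr)
    assume "b \<noteq> c"
    \<comment> \<open>In \<open>Z2\<close>, adding \<open>1\<close> gives the other value.\<close>
    moreover have "a + 1 \<noteq> a" using Z2_cases[of a] by auto
    ultimately have "forces (y, b) (x, a + 1)"
      using forces_contrapositive[OF that(2)] dom[OF that(1)] by blast
    with closed[OF that(1)] new show False by force
  qed
  show ?thesis
    unfolding partial_solution_def
  proof (intro conjI)
    show "\<forall>(y, b)\<in>S \<union> {t. forces (x, a) t}. y \<in> V \<and> b \<in> D y"
      using dom forces_dom x(2) by auto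
    show "\<forall>y b c. (y, b) \<in> S \<union> {t. forces (x, a) t} \<longrightarrow> (y, c) \<in> S \<union> {t. forces (x, a) t} \<longrightarrow> b = c"
      using uniq clash unrefuted_forces_consistent[OF x(3)] by (metis UnE mem_Collect_eq)
    show "\<forall>s\<in>S \<union> {t. forces (x, a) t}. \<forall>t. forces s t \<longrightarrow> t \<in> S \<union> {t. forces (x, a) t}"
      using closed forces_trans by blast
  qed
qed

text \<open>Induction on \<open>W\<close>. A vertex already labelled by what earlier choices force
  keeps that label; only an unlabelled one receives a new unrefuted value.\<close>

lemma partial_solution_covering:
  assumes "\<And>x. x \<in> V \<Longrightarrow> \<exists>a\<in>D x. unrefuted x a" "finite W" "W \<subseteq> V"
  shows "\<exists>S. partial_solution S \<and> W \<subseteq> fst ` S"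
  using assms(2,3)
proof (induction W)
  case empty
  have "partial_solution {}" by (simp add: partial_solution_def)
  then show ?case by blast
next
  case (insert x W)
  then obtain S where S: "partial_solution S" "W \<subseteq> fst ` S" by auto
  show ?case
  proof (cases "x \<in> fst ` S")
    case True
    then show ?thesis using S by blast
  next
    case False
    obtain a where "a \<in> D x" "unrefuted x a" using assms(1) insert.prems by blast
    then have "partial_solution (S \<union> {t. forces (x, a) t})"
      using extend_partial_solution S(1) False insert.prems by blast
    moreover have "insert x W \<subseteq> fst ` (S \<union> {t. forces (x, a) t})"
      using S(2) forces_refl[of x a] insert.prems by force
    ultimately show ?thesis by blast
  qed
qed

text \<open>A partial solution covering \<open>V\<close> is the graph of a function. A violated
  constraint would force the other value at its target, and closure would make the graph two-valued
  there.\<close>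

lemma solution_exists:
  assumes "\<And>x. x \<in> V \<Longrightarrow> \<exists>a\<in>D x. unrefuted x a"
  shows "\<exists>v. (\<forall>x\<in>V. v x \<in> D x) \<and> (\<forall>x y. \<forall>M\<in>H x y. M $ v x $ v y)"
proof -
  obtain S where S: "partial_solution S" "V \<subseteq> fst ` S"
    using partial_solution_covering[OF assms finite_V] by auto
  then have "\<forall>x\<in>V. \<exists>a. (x, a) \<in> S" by force
  then obtain v where v: "\<And>x. x \<in> V \<Longrightarrow> (x, v x) \<in> S" by metis
  have dom: "v x \<in> D x" if "x \<in> V" for x
    using S(1) v[OF that] unfolding partial_solution_def by blast
  have "M $ v x $ v y" if M: "M \<in> H x y" for x y M
  proof (rule ccontr)
    assume "\<not> M $ v x $ v y"
    moreover have neq: "v y + 1 \<noteq> v y" using Z2_cases[of "v y"] by auto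
    ultimately have "forces (x, v x) (y, v y + 1)"
      using failure_forces M dom hom_V by blast
    then have "(y, v y + 1) \<in> S"
      using S(1) v hom_V[OF M] unfolding partial_solution_def by blast
    then show False
      using S(1) v hom_V[OF M] neq unfolding partial_solution_def by blast
  qed
  with dom show ?thesis by blast
qed

section \<open>Vertices with both values refuted\<close>

lemma refuted_dom:
  assumes "x \<in> V" "\<And>a. a \<in> D x \<Longrightarrow> \<not> unrefuted x a"
  shows "D x = UNIV"
proof -
  obtain a where a: "a \<in> D x" using dom_nonempty[OF assms(1)] by blast
  then obtain M where "M \<in> H x x" "\<not> M $ a $ a"
    using assms(2) unfolding unrefuted_def by blast
  \<comment> \<open>Row \<open>a\<close> of \<open>M\<close> misses column \<open>a\<close>, but
    \<open>total\<close> gives it a nonzero entry at a possible value, which must be the other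
    one.\<close>
  then obtain b where b: "b \<in> D x" "b \<noteq> a" using total a by metis
  have "c \<in> D x" for c
    using a b Z2_neq_trans[of b a c] by (cases "c = a") auto
  then show ?thesis by blast
qed

lemma unsatisfiable_loops:
  assumes "\<not> (\<exists>v. (\<forall>x\<in>V. v x \<in> D x) \<and> (\<forall>x y. \<forall>M\<in>H x y. M $ v x $ v y))"
  shows "\<exists>x\<in>V. {mat2 1 1 1 0, mat2 0 1 1 1} \<subseteq> H x x \<or> mat2 0 1 1 0 \<in> H x x"
proof -
  obtain x where x: "x \<in> V" "\<And>a. a \<in> D x \<Longrightarrow> \<not> unrefuted x a"
    using assms solution_exists by blast
  then have D: "D x = UNIV" by (rule refuted_dom)
  obtain M N where M: "M \<in> H x x" "\<not> M $ 0 $ 0" and N: "N \<in> H x x" "\<not> N $ 1 $ 1"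
    using x(2) unfolding unrefuted_def D by blast
  \<comment> \<open>Since every value is possible at \<open>x\<close>, totality excludes zero rows
    of a loop, and totality of the transpose excludes zero columns.\<close>
  have rows: "\<exists>b. L $ a $ b" and cols: "\<exists>b. L $ b $ a" if "L \<in> H x x" for L a
    using total[OF that, of a] total[OF hom_transpose[OF that], of a] D
    by (auto simp: transpose_def)
  have M': "M $ 0 $ 1" "M $ 1 $ 0" and N': "N $ 0 $ 1" "N $ 1 $ 0"
    using rows[OF M(1), of 0] cols[OF M(1), of 0] rows[OF N(1), of 1] cols[OF N(1), of 1]
      M(2) N(2) Z2_cases by metis+
  \<comment> \<open>The zero on the diagonal makes both off-diagonal entries \<open>1\<close>; only
    the other diagonal entry remains free.\<close>
  have "M = mat2 0 1 1 (M $ 1 $ 1)" "N = mat2 (N $ 0 $ 0) 1 1 0"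
    using M(2) N(2) M' N' by (auto intro!: mat2_eqI simp: zero_bool_def one_bool_def)
  then have "M = mat2 0 1 1 1 \<or> M = mat2 0 1 1 0" "N = mat2 1 1 1 0 \<or> N = mat2 0 1 1 0"
    by (cases "M $ 1 $ 1"; cases "N $ 0 $ 0"; simp add: zero_bool_def one_bool_def)+
  then show ?thesis using M(1) N(1) x(1) by blast
qed

end

section \<open>Simplicial maps into \<open>\<Delta>\<close>\<close>

text \<open>Vertex \<open>0\<close> of a simplex, reached by repeatedly deleting the last
  vertex.\<close>

primrec initial_vertex :: "'a sset \<Rightarrow> nat \<Rightarrow> 'a \<Rightarrow> 'a" where
  "initial_vertex X 0 x = x"
| "initial_vertex X (Suc n) x = initial_vertex X n (face X (Suc n) (Suc n) x)"

text \<open>The labels of vertices \<open>0\<close> to \<open>n\<close> in order; \<open>d_0\<close>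
  passes to the remaining vertices. This extends a labelling of vertices to a map into
  \<open>Delta\<close>.\<close>

primrec vertex_labels :: "'a sset \<Rightarrow> ('a \<Rightarrow> 'u) \<Rightarrow> nat \<Rightarrow> 'a \<Rightarrow> 'u list" where
  "vertex_labels X v 0 x = [v x]"
| "vertex_labels X v (Suc n) x =
     v (initial_vertex X (Suc n) x) # vertex_labels X v n (face X (Suc n) 0 x)"

context simplicial_set
begin

text \<open>The top face is the defining case; any lower \<open>d_i\<close> commutes past the top
  face, leaving the claim one degree down.\<close>

lemma initial_vertex_face:
  assumes "x \<in> simplices X (Suc n)" "0 < i" "i \<le> Suc n"
  shows "initial_vertex X n (face X (Suc n) i x) = initial_vertex X (Suc n) x"
  using assms
proof (induction n arbitrary: x i)
  case 0
  then have "i = 1" by simp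
  then show ?case by simp
next
  case (Suc n)
  show ?case
  proof (cases "i = Suc (Suc n)")
    case True
    then show ?thesis by simp
  next
    case False
    then have "face X (Suc n) (Suc n) (face X (Suc (Suc n)) i x) =
        face X (Suc n) i (face X (Suc (Suc n)) (Suc (Suc n)) x)"
      using face_face[OF Suc.prems(1), of i "Suc (Suc n)"] Suc.prems by simp
    moreover have "initial_vertex X n (face X (Suc n) i (face X (Suc (Suc n)) (Suc (Suc n)) x)) =
        initial_vertex X (Suc n) (face X (Suc (Suc n)) (Suc (Suc n)) x)"
      using Suc.prems False by (intro Suc.IH face_closed) auto
    ultimately show ?thesis by simp
  qed
qed

lemma initial_vertex_degen:
  assumes "x \<in> simplices X n" "j \<le> n"
  shows "initial_vertex X (Suc n) (degen X n j x) = initial_vertex X n x"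
  using assms
proof (induction n arbitrary: x j)
  case 0
  then show ?case using face_degen_Suc[OF 0(1), of 0] by simp
next
  case (Suc n)
  show ?case
  proof (cases "j = Suc n")
    case True
    then show ?thesis using face_degen_Suc[OF Suc.prems(1), of j] by simp
  next
    case False
    then have "face X (Suc (Suc n)) (Suc (Suc n)) (degen X (Suc n) j x) =
        degen X n j (face X (Suc n) (Suc n) x)"
      using face_degen_greater[OF Suc.prems(1), of j "Suc (Suc n)"] Suc.prems by simp
    moreover have "initial_vertex X (Suc n) (degen X n j (face X (Suc n) (Suc n) x)) =
        initial_vertex X n (face X (Suc n) (Suc n) x)"
      using Suc.prems False by (intro Suc.IH face_closed) auto
    ultimately show ?thesis by simp
  qed
qed

text \<open>\<open>d_0\<close> removes the head by definition. For \<open>i > 0\<close> the head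
  survives, and \<open>d_0 d_i = d_{i-1} d_0\<close> moves the deletion into the tail.\<close>

lemma vertex_labels_face:
  assumes "x \<in> simplices X (Suc n)" "i \<le> Suc n"
  shows "vertex_labels X v n (face X (Suc n) i x) =
    take i (vertex_labels X v (Suc n) x) @ drop (Suc i) (vertex_labels X v (Suc n) x)"
  using assms
proof (induction n arbitrary: x i)
  case 0
  then have "i = 0 \<or> i = 1" by auto
  then show ?case by auto
next
  case (Suc n)
  show ?case
  proof (cases i)
    case 0
    then show ?thesis by simp
  next
    case (Suc k)
    have "face X (Suc n) 0 (face X (Suc (Suc n)) i x) =
        face X (Suc n) k (face X (Suc (Suc n)) 0 x)"
      using face_face[OF Suc.prems(1), of 0 i] Suc.prems Suc by simp
    moreover have "vertex_labels X v n (face X (Suc n) k (face X (Suc (Suc n)) 0 x)) =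
        take k (vertex_labels X v (Suc n) (face X (Suc (Suc n)) 0 x)) @
        drop (Suc k) (vertex_labels X v (Suc n) (face X (Suc (Suc n)) 0 x))"
      using Suc.prems Suc by (intro Suc.IH face_closed) auto
    moreover have "initial_vertex X (Suc n) (face X (Suc (Suc n)) i x) =
        initial_vertex X (Suc (Suc n)) x"
      using Suc.prems Suc by (intro initial_vertex_face) auto
    ultimately show ?thesis
      unfolding vertex_labels.simps(2)[of X v "Suc n" x]
      by (simp add: Suc del: vertex_labels.simps(2) initial_vertex.simps(2))
         (simp add: vertex_labels.simps(2) del: initial_vertex.simps(2))
  qed
qed

text \<open>For \<open>j = 0\<close>, \<open>d_0 s_0\<close> is the identity, so the head is
  repeated. Otherwise \<open>d_0 s_j = s_{j-1} d_0\<close> moves the repetition into the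
  tail.\<close>

lemma vertex_labels_degen:
  assumes "x \<in> simplices X n" "j \<le> n"
  shows "vertex_labels X v (Suc n) (degen X n j x) =
    take (Suc j) (vertex_labels X v n x) @ drop j (vertex_labels X v n x)"
  using assms
proof (induction n arbitrary: x j)
  case 0
  then show ?case
    using initial_vertex_degen[OF 0] face_degen_same[OF 0]
    by (simp del: initial_vertex.simps(2))
next
  case (Suc n)
  have hd: "initial_vertex X (Suc (Suc n)) (degen X (Suc n) j x) = initial_vertex X (Suc n) x"
    using Suc.prems by (rule initial_vertex_degen)
  show ?case
  proof (cases j)
    case 0
    then show ?thesis
      using hd face_degen_same[OF Suc.prems] by (simp del: initial_vertex.simps(2))
  next
    case (Suc k)
    have "face X (Suc (Suc n)) 0 (degen X (Suc n) j x) = degen X n k (face X (Suc n) 0 x)"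
      using face_degen_less[OF Suc.prems(1), of 0 j] Suc.prems Suc by simp
    moreover have "vertex_labels X v (Suc n) (degen X n k (face X (Suc n) 0 x)) =
        take (Suc k) (vertex_labels X v n (face X (Suc n) 0 x)) @
        drop k (vertex_labels X v n (face X (Suc n) 0 x))"
      using Suc.prems Suc by (intro Suc.IH face_closed) auto
    ultimately show ?thesis
      unfolding vertex_labels.simps(2)[of X v "Suc n" "degen X (Suc n) j x"]
      using hd Suc by (simp del: vertex_labels.simps(2) initial_vertex.simps(2))
         (simp add: vertex_labels.simps(2) del: initial_vertex.simps(2))
  qed
qed

lemma length_vertex_labels: "length (vertex_labels X v n x) = Suc n"
  by (induction n arbitrary: x) auto

lemma simplicial_map_vertex_labels: "simplicial_map X (Delta UNIV) (vertex_labels X v)"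
  unfolding simplicial_map_def
  by (simp add: Delta_def length_vertex_labels vertex_labels_face vertex_labels_degen
      del: vertex_labels.simps)

end

section \<open>Contextuality as unsatisfiability\<close>

locale distribution_on_sset = simplicial_set X
  for X :: "'a sset" and p :: "nat \<Rightarrow> 'a \<Rightarrow> Z2 list \<Rightarrow> bool" +
  assumes dist: "simplicial_distribution X p"
begin

definition outcomes :: "'a \<Rightarrow> Z2 set" where
  "outcomes x = {a. p 0 x [a]}"

section \<open>Supports of \<open>p\<close> on vertices and edges\<close>

lemma p_distB: "x \<in> simplices X n \<Longrightarrow> p n x \<in> distB {s. length s = Suc n}"
  using dist by (auto simp: simplicial_distribution_def simplicial_map_def DB_def Delta_def)

lemma p_finite: "x \<in> simplices X n \<Longrightarrow> finite {s. p n x s \<noteq> 0}"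
  using p_distB[of x n] by (simp add: distB_iff zero_bool_def)

lemma p_length: "x \<in> simplices X n \<Longrightarrow> p n x s \<Longrightarrow> length s = Suc n"
  using p_distB[of x n] by (simp add: distB_iff)

lemma p_face:
  assumes "x \<in> simplices X (Suc n)" "i \<le> Suc n"
  shows "p n (face X (Suc n) i x) t \<longleftrightarrow> (\<exists>s. p (Suc n) x s \<and> take i s @ drop (Suc i) s = t)"
proof -
  have "p n (face X (Suc n) i x) = distB_map (\<lambda>s. take i s @ drop (Suc i) s) (p (Suc n) x)"
    using dist assms by (simp add: simplicial_distribution_def simplicial_map_def DB_def Delta_def)
  then show ?thesis using distB_map_iff[OF p_finite[OF assms(1)]] by simp
qed

lemma p_degen:
  assumes "x \<in> simplices X n" "j \<le> n"
  shows "p (Suc n) (degen X n j x) t \<longleftrightarrow> (\<exists>s. p n x s \<and> take (Suc j) s @ drop j s = t)"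
proof -
  have "p (Suc n) (degen X n j x) = distB_map (\<lambda>s. take (Suc j) s @ drop j s) (p n x)"
    using dist assms by (simp add: simplicial_distribution_def simplicial_map_def DB_def Delta_def)
  then show ?thesis using distB_map_iff[OF p_finite[OF assms(1)]] by simp
qed

text \<open>\<open>d_1\<close> deletes entry \<open>1\<close> of a pair, so compatibility of
  \<open>p\<close> with \<open>d_1\<close> makes the source carry the first marginal.\<close>

lemma outcomes_source:
  assumes "\<sigma> \<in> simplices X 1"
  shows "a \<in> outcomes (face X 1 1 \<sigma>) \<longleftrightarrow> (\<exists>b. p 1 \<sigma> [a, b])"
proof -
  have "a \<in> outcomes (face X 1 1 \<sigma>) \<longleftrightarrow> (\<exists>s. p 1 \<sigma> s \<and> take 1 s @ drop 2 s = [a])"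
    using p_face[of \<sigma> 0 1] assms by (simp add: outcomes_def numeral_2_eq_2)
  also have "\<dots> \<longleftrightarrow> (\<exists>b. p 1 \<sigma> [a, b])"
  proof
    assume "\<exists>s. p 1 \<sigma> s \<and> take 1 s @ drop 2 s = [a]"
    then obtain s where s: "p 1 \<sigma> s" "take 1 s @ drop 2 s = [a]" by blast
    moreover have "length s = 2" using p_length[OF assms s(1)] by simp
    then obtain c d where "s = [c, d]" by (auto simp: length_Suc_conv numeral_2_eq_2)
    ultimately show "\<exists>b. p 1 \<sigma> [a, b]" by auto
  next
    assume "\<exists>b. p 1 \<sigma> [a, b]"
    then obtain b where "p 1 \<sigma> [a, b]" by blast
    then show "\<exists>s. p 1 \<sigma> s \<and> take 1 s @ drop 2 s = [a]" by (intro exI[of _ "[a, b]"]) simp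
  qed
  finally show ?thesis .
qed

lemma outcomes_target:
  assumes "\<sigma> \<in> simplices X 1"
  shows "b \<in> outcomes (face X 1 0 \<sigma>) \<longleftrightarrow> (\<exists>a. p 1 \<sigma> [a, b])"
proof -
  have "b \<in> outcomes (face X 1 0 \<sigma>) \<longleftrightarrow> (\<exists>s. p 1 \<sigma> s \<and> drop 1 s = [b])"
    using p_face[of \<sigma> 0 0] assms by (simp add: outcomes_def)
  also have "\<dots> \<longleftrightarrow> (\<exists>a. p 1 \<sigma> [a, b])"
  proof
    assume "\<exists>s. p 1 \<sigma> s \<and> drop 1 s = [b]"
    then obtain s where s: "p 1 \<sigma> s" "drop 1 s = [b]" by blast
    moreover have "length s = 2" using p_length[OF assms s(1)] by simp
    then obtain c d where "s = [c, d]" by (auto simp: length_Suc_conv numeral_2_eq_2)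
    ultimately show "\<exists>a. p 1 \<sigma> [a, b]" by auto
  next
    assume "\<exists>a. p 1 \<sigma> [a, b]"
    then obtain a where "p 1 \<sigma> [a, b]" by blast
    then show "\<exists>s. p 1 \<sigma> s \<and> drop 1 s = [b]" by (intro exI[of _ "[a, b]"]) simp
  qed
  finally show ?thesis .
qed

section \<open>Edges, paths and morphisms as an arc consistent system\<close>

lemma edge_cases:
  assumes "(x, M, y) \<in> edges X p"
  obtains \<sigma> where "nondegenerate X 1 \<sigma>" "\<sigma> \<in> simplices X 1"
      "x = face X 1 1 \<sigma>" "y = face X 1 0 \<sigma>" "\<And>a b. M $ a $ b \<longleftrightarrow> p 1 \<sigma> [a, b]"
    | \<sigma> where "nondegenerate X 1 \<sigma>" "\<sigma> \<in> simplices X 1"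
      "x = face X 1 0 \<sigma>" "y = face X 1 1 \<sigma>" "\<And>a b. M $ a $ b \<longleftrightarrow> p 1 \<sigma> [b, a]"
  using assms unfolding edges_def edge_matrix_def nondegenerate_def
  by (fastforce simp: transpose_def)

text \<open>The supports at both endpoints are the marginals of the same edge distribution: one
  gives a nonzero entry in row \<open>a\<close>, the other makes its column an outcome at
  \<open>y\<close>.\<close>

lemma edge_total:
  assumes "(x, M, y) \<in> edges X p" "a \<in> outcomes x"
  shows "\<exists>b\<in>outcomes y. M $ a $ b"
  using assms(1)
proof (cases rule: edge_cases)
  case (1 \<sigma>)
  then show ?thesis using assms(2) outcomes_source[OF 1(2)] outcomes_target[OF 1(2)] by metis
next
  case (2 \<sigma>)
  then show ?thesis using assms(2) outcomes_source[OF 2(2)] outcomes_target[OF 2(2)] by metis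
qed

lemma path_total:
  "is_path (edges X p) x es y \<Longrightarrow> a \<in> outcomes x \<Longrightarrow> \<exists>b\<in>outcomes y. path_product es $ a $ b"
proof (induction es arbitrary: x a)
  case Nil
  then show ?case by (auto simp: bool_mat_1_iff)
next
  case (Cons e es)
  obtain u M w where e: "e = (u, M, w)" by (cases e)
  with Cons.prems obtain b where "b \<in> outcomes w" "M $ a $ b"
    using edge_total[of u M w a] by auto
  moreover with Cons e obtain c where "c \<in> outcomes y" "path_product es $ b $ c"
    by (metis is_path.simps(2))
  ultimately show ?case by (auto simp: e bool_matrix_mult_iff)
qed

lemma edges_sym: "(x, M, y) \<in> edges X p \<Longrightarrow> (y, transpose M, x) \<in> edges X p"
  unfolding edges_def by auto

lemma edges_vertices: "(x, M, y) \<in> edges X p \<Longrightarrow> x \<in> simplices X 0 \<and> y \<in> simplices X 0"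
  by (erule edge_cases) (use face_closed[of _ 0] in auto)

lemma edge_in_Hom_cat: "(x, M, y) \<in> edges X p \<Longrightarrow> M \<in> Hom_cat X p x y"
  using edges_vertices[of x M y]
  by (auto simp: Hom_cat_def matrix_mul_rid intro!: exI[of _ "[(x, M, y)]"])

text \<open>Reverse the path: each edge has a reversed edge with transposed label, and transposition
  reverses products.\<close>

lemma Hom_cat_transpose:
  assumes "M \<in> Hom_cat X p x y"
  shows "transpose M \<in> Hom_cat X p y x"
proof -
  have "transpose (path_product es) \<in> Hom_cat X p y x"
    if "is_path (edges X p) x es y" "x \<in> simplices X 0" for es x
    using that
  proof (induction es arbitrary: x)
    case Nil
    then show ?case by (simp add: Hom_cat_id)
  next
    case (Cons e es)
    obtain u M w where e: "e = (u, M, w)" by (cases e)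
    with Cons.prems have edge: "(x, M, w) \<in> edges X p" by auto
    have "transpose (path_product es) \<in> Hom_cat X p y w"
      using Cons e edges_vertices[OF edge] by simp
    from Hom_cat_comp[OF this edge_in_Hom_cat[OF edges_sym[OF edge]]]
    show ?case by (simp add: e matrix_transpose_mul)
  qed
  then show ?thesis using assms by (auto simp: Hom_cat_def)
qed

lemma boolean_constraints_Hom_cat:
  assumes "finite (simplices X 0)"
  shows "boolean_constraints (simplices X 0) (Hom_cat X p) outcomes"
proof
  show "finite (simplices X 0)" by fact
  show "outcomes x \<noteq> {}" if x: "x \<in> simplices X 0" for x
  proof -
    obtain s where s: "p 0 x s" using p_distB[OF x] by (auto simp: distB_iff)
    then obtain a where "s = [a]" using p_length[OF x] by (auto simp: length_Suc_conv)
    then show ?thesis using s by (auto simp: outcomes_def)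
  qed
  show "\<exists>b\<in>outcomes y. M $ a $ b" if "M \<in> Hom_cat X p x y" "a \<in> outcomes x" for M x y a
    using that path_total by (auto simp: Hom_cat_def)
qed (auto simp: Hom_cat_id intro: Hom_cat_comp Hom_cat_transpose, auto simp: Hom_cat_def)

section \<open>Solutions correspond to simplicial maps in the support of \<open>p\<close>\<close>

lemma vertex_labels_supported:
  assumes "skeletal 1 X" "\<And>x. x \<in> simplices X 0 \<Longrightarrow> v x \<in> outcomes x"
    and "\<And>x y M. M \<in> Hom_cat X p x y \<Longrightarrow> M $ v x $ v y"
    and "x \<in> simplices X n"
  shows "p n x (vertex_labels X v n x)"
  using assms(4)
proof (induction n arbitrary: x)
  case 0
  then show ?case using assms(2) by (simp add: outcomes_def)
next
  case (Suc n)
  show ?case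
  proof (cases "nondegenerate X (Suc n) x")
    case True
    \<comment> \<open>Being \<open>1\<close>-skeletal leaves only edges here, and the matrix of a
      non-degenerate edge is itself a morphism.\<close>
    then have n: "n = 0" using assms(1) unfolding skeletal_def by fastforce
    have "(face X 1 1 x, edge_matrix p x, face X 1 0 x) \<in> edges X p"
      using True n by (auto simp: edges_def)
    from assms(3)[OF edge_in_Hom_cat[OF this]] show ?thesis
      by (simp add: n edge_matrix_def)
  next
    case False
    \<comment> \<open>A degenerate simplex inherits support from \<open>y\<close>, since
      \<open>s_j\<close> repeats the same entry in the labels and in the outcomes of
      \<open>p\<close>.\<close>
    then obtain j y where y: "j \<le> n" "y \<in> simplices X n" "x = degen X n j y"
      using Suc.prems unfolding nondegenerate_def by blast
    then show ?thesis
      using Suc.IH[OF y(2)] p_degen[OF y(2,1)] vertex_labels_degen[OF y(2,1)] by metis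
  qed
qed

lemma strongly_contextual_iff_unsatisfiable:
  assumes "skeletal 1 X"
  shows "strongly_contextual X p \<longleftrightarrow>
    \<not> (\<exists>v. (\<forall>x\<in>simplices X 0. v x \<in> outcomes x) \<and>
           (\<forall>x y. \<forall>M\<in>Hom_cat X p x y. M $ v x $ v y))"
    (is "_ \<longleftrightarrow> \<not> ?sat")
proof
  assume sc: "strongly_contextual X p"
  show "\<not> ?sat"
  proof
    assume ?sat
    then obtain v where "\<And>x. x \<in> simplices X 0 \<Longrightarrow> v x \<in> outcomes x"
      "\<And>x y M. M \<in> Hom_cat X p x y \<Longrightarrow> M $ v x $ v y" by blast
    from vertex_labels_supported[OF assms this] simplicial_map_vertex_labels[of v] sc
    show False unfolding strongly_contextual_def zero_bool_def by blast
  qed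
next
  assume unsat: "\<not> ?sat"
  show "strongly_contextual X p"
    unfolding strongly_contextual_def
  proof (intro notI, elim exE conjE)
    fix \<phi>
    assume map: "simplicial_map X (Delta (UNIV :: Z2 set)) \<phi>"
      and supp: "\<forall>n. \<forall>x\<in>simplices X n. p n x (\<phi> n x) \<noteq> 0"
    \<comment> \<open>On vertices \<open>\<phi>\<close> yields one-element lists, so
      \<open>hd\<close> loses nothing.\<close>
    define v where "v x = hd (\<phi> 0 x)" for x
    have len: "length (\<phi> n x) = Suc n" if "x \<in> simplices X n" for n x
      using map that by (simp add: simplicial_map_def Delta_def)
    have vertex: "\<phi> 0 x = [v x]" if "x \<in> simplices X 0" for x
      using len[OF that] by (auto simp: v_def length_Suc_conv)
    have edge: "\<phi> 1 \<sigma> = [v (face X 1 1 \<sigma>), v (face X 1 0 \<sigma>)]" if \<sigma>: "\<sigma> \<in> simplices X 1" for \<sigma>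
    proof -
      obtain a b where ab: "\<phi> 1 \<sigma> = [a, b]"
        using len[OF \<sigma>] by (auto simp: length_Suc_conv)
      have "\<phi> 0 (face X 1 i \<sigma>) = take i [a, b] @ drop (Suc i) [a, b]" if "i \<le> 1" for i
        using map \<sigma> that ab[symmetric] by (simp add: simplicial_map_def Delta_def)
      from this[of 0] this[of 1] ab show ?thesis by (simp add: v_def)
    qed
    have "M $ v x $ v y" if "(x, M, y) \<in> edges X p" for x M y
      using that by (cases rule: edge_cases) (use supp edge in \<open>force simp: zero_bool_def\<close>)+
    \<comment> \<open>The label \<open>v w\<close> at each intermediate vertex is the summation
      index witnessing a nonzero product entry.\<close>
    then have "path_product es $ v x $ v y" if "is_path (edges X p) x es y" for es x y
      using that
    proof (induction es arbitrary: x)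
      case Nil
      then show ?case by (simp add: bool_mat_1_iff)
    next
      case (Cons e es)
      obtain u M w where "e = (u, M, w)" by (cases e)
      with Cons have "M $ v x $ v w" "path_product es $ v w $ v y" by auto
      then show ?case by (auto simp: \<open>e = (u, M, w)\<close> bool_matrix_mult_iff)
    qed
    then have "M $ v x $ v y" if "M \<in> Hom_cat X p x y" for M x y
      using that by (auto simp: Hom_cat_def)
    moreover have "v x \<in> outcomes x" if "x \<in> simplices X 0" for x
      using supp vertex that by (force simp: outcomes_def zero_bool_def)
    ultimately show False using unsat by blast
  qed
qed

end

theorem proposition4p26:
  fixes X :: "'a sset" and p :: "nat \<Rightarrow> 'a \<Rightarrow> Z2 list \<Rightarrow> bool"
  assumes "simplicial_set X"
    and "skeletal 1 X"
    and "finite {(n, x). nondegenerate X n x}"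
    and "simplicial_distribution X p"
  shows "strongly_contextual X p \<longleftrightarrow>
    (\<exists>x\<in>simplices X 0.
       {mat2 1 1 1 0, mat2 0 1 1 1} \<subseteq> Hom_cat X p x x \<or>
       mat2 0 1 1 0 \<in> Hom_cat X p x x)"
proof -
  interpret distribution_on_sset X p
    using assms(1,4) by (simp add: distribution_on_sset_def distribution_on_sset_axioms_def)
  \<comment> \<open>Simplices of degree \<open>0\<close> are never degenerate, so finiteness passes
    to the vertex set.\<close>
  have "simplices X 0 \<subseteq> snd ` {(n, x). nondegenerate X n x}"
    by (force simp: nondegenerate_def)
  then have "finite (simplices X 0)"
    using assms(3) finite_surj by blast
  then interpret C: boolean_constraints "simplices X 0" "Hom_cat X p" outcomes
    by (rule boolean_constraints_Hom_cat)
  note unsat_iff = strongly_contextual_iff_unsatisfiable[OF assms(2)]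
  show ?thesis
  proof
    assume "strongly_contextual X p"
    then show "\<exists>x\<in>simplices X 0. {mat2 1 1 1 0, mat2 0 1 1 1} \<subseteq> Hom_cat X p x x \<or>
        mat2 0 1 1 0 \<in> Hom_cat X p x x"
      unfolding unsat_iff by (rule C.unsatisfiable_loops)
  next
    assume "\<exists>x\<in>simplices X 0. {mat2 1 1 1 0, mat2 0 1 1 1} \<subseteq> Hom_cat X p x x \<or>
        mat2 0 1 1 0 \<in> Hom_cat X p x x"
    then obtain x where x: "{mat2 1 1 1 0, mat2 0 1 1 1} \<subseteq> Hom_cat X p x x \<or>
        mat2 0 1 1 0 \<in> Hom_cat X p x x" by blast
    show "strongly_contextual X p"
      unfolding unsat_iff
    proof (intro notI, elim exE conjE)
      fix v
      assume "\<forall>x y. \<forall>M\<in>Hom_cat X p x y. M $ v x $ v y"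
      \<comment> \<open>A solution picks a diagonal position where every loop is nonzero, yet
        \<open>A\<close> vanishes at \<open>(1, 1)\<close>, \<open>D\<close> at
        \<open>(0, 0)\<close> and the swap at both.\<close>
      then have "mat2 1 1 1 0 $ v x $ v x \<and> mat2 0 1 1 1 $ v x $ v x \<or> mat2 0 1 1 0 $ v x $ v x"
        using x by blast
      then show False
        using Z2_cases[of "v x"] by (auto simp: mat2_def zero_bool_def)
    qed
  qed
qed

end
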